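(* The quasi-order of inclusion on the power set of $\omega$ can be embedded into each of the following: (a) the quasi-order $\preceq^i_c$ on the class of graphs induced by a (total) homeomorphism of a countable 0DMC (and thus 0DP, 0DMS) space with CCN three; that is, there is a map $A\mapsto(X_A,G_A)$ from the power set of $\omega$ into this class such that $A\subseteq B\Leftrightarrow(X_A,G_A)\preceq^i_c(X_B,G_B)$ for all $A,B\subseteq\omega$; (b) the quasi-order $\preceq_c$ on the class of countable graphs on a 0DMC (and thus 0DP, 0DMS) space with CCN three; that is, there is a map $A\mapsto(Y_A,H_A)$ from the power set of $\omega$ into this class such that $A\subseteq B\Leftrightarrow(Y_A,H_A)\preceq_c(Y_B,H_B)$ for all $A,B\subseteq\omega$.
   Context: 0DMS, 0DP, 0DMC mean zero-dimensional (having a basis of clopen sets) and, respectively, metrizable separable, Polish, metrizable compact. A digraph on $X$ is a binary relation $R\subseteq X^2$ disjoint from the diagonal $\Delta(X)$; a graph is a symmetric digraph; it is countable if it is countable as a set of pairs. If $f:X\to X$ is a function, the graph induced by $f$ is $G_f=\big(\mathrm{Graph}(f)\cup\mathrm{Graph}(f)^{-1}\big)\setminus\Delta(X)$. The continuous chromatic number (CCN) of $(X,R)$ is the least cardinal $\kappa\leq\aleph_0$ for which there is a continuous map $c:X\to\kappa$ ($\kappa$ discrete) with $c(x)\neq c(y)$ whenever $(x,y)\in R$, if it exists, and $2^{\aleph_0}$ otherwise. $(X,R)\preceq_c(Y,S)$ means that there is a continuous $\varphi:X\to Y$ with $R\subseteq(\varphi\times\varphi)^{-1}(S)$; $(X,R)\preceq^i_c(Y,S)$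 means that moreover $\varphi$ can be chosen injective. *)

theory Defs
  imports "HOL-Analysis.Analysis" "HOL-Library.Extended_Nat"
begin

section \<open>Zero-dimensional spaces\<close>

definition zero_dimensional :: "'a topology \<Rightarrow> bool" where
  "zero_dimensional X \<longleftrightarrow>
     (\<exists>\<B>. (\<forall>V\<in>\<B>. openin X V \<and> closedin X V) \<and>
          (\<forall>U x. openin X U \<and> x \<in> U \<longrightarrow> (\<exists>V\<in>\<B>. x \<in> V \<and> V \<subseteq> U)))"

definition zdms_space :: "'a topology \<Rightarrow> bool" where
  "zdms_space X \<longleftrightarrow> zero_dimensional X \<and> metrizable_space X \<and> separable_space X"

definition zdp_space :: "'a topology \<Rightarrow> bool" where
  "zdp_space X \<longleftrightarrow> zero_dimensional X \<and> completely_metrizable_space X \<and> separable_space X"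

definition zdmc_space :: "'a topology \<Rightarrow> bool" where
  "zdmc_space X \<longleftrightarrow> zero_dimensional X \<and> metrizable_space X \<and> compact_space X"

lemma zero_dimensional_iff_dim_le_0: "zero_dimensional X \<longleftrightarrow> X dim_le 0"
proof -
  have "zero_dimensional X \<longleftrightarrow>
      (\<forall>U x. openin X U \<and> x \<in> U \<longrightarrow> (\<exists>V. openin X V \<and> closedin X V \<and> x \<in> V \<and> V \<subseteq> U))"
    (is "?L \<longleftrightarrow> ?R")
  proof
    show "?L \<Longrightarrow> ?R" unfolding zero_dimensional_def by meson
    assume ?R
    then show ?L unfolding zero_dimensional_def
      by (intro exI[of _ "{V. openin X V \<and> closedin X V}"]) auto
  qed
  also have "\<dots> \<longleftrightarrow> X dim_le 0"
    unfolding dimension_le_0_neighbourhood_base_of_clopen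
    by (subst open_neighbourhood_base_of) (blast, meson)
  finally show ?thesis .
qed

lemma compact_metrizable_imp_separable:
  assumes "metrizable_space X" "compact_space X"
  shows "separable_space X"
proof -
  obtain M d where "Metric_space M d" and X: "X = Metric_space.mtopology M d"
    using assms(1) metrizable_space_def by blast
  interpret Metric_space M d by fact
  have "mtotally_bounded M"
    using assms(2) compact_space_eq_mcomplete_mtotally_bounded X by blast
  then have "\<forall>n. \<exists>K. finite K \<and> K \<subseteq> M \<and> M \<subseteq> (\<Union>x\<in>K. mball x (inverse (Suc n)))"
    unfolding mtotally_bounded_def by (metis inverse_positive_iff_positive of_nat_0_less_iff zero_less_Suc)
  then obtain K where K: "\<And>n::nat. finite (K n)" "\<And>n. K n \<subseteq> M"
      "\<And>n. M \<subseteq> (\<Union>x\<in>K n. mball x (inverse (Suc n)))" by metis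
  have "M \<subseteq> mtopology closure_of (\<Union>n. K n)"
  proof
    fix y assume y: "y \<in> M"
    have "\<exists>z\<in>(\<Union>n. K n). z \<in> mball y r" if r: "r > 0" for r
    proof -
      obtain n where n: "inverse (real (Suc n)) < r" using reals_Archimedean r by blast
      obtain x where x: "x \<in> K n" "y \<in> mball x (inverse (Suc n))" using K(3)[of n] y by auto
      then have "x \<in> mball y r" using n by (auto simp: commute)
      then show ?thesis using x by blast
    qed
    then show "y \<in> mtopology closure_of (\<Union>n. K n)"
      unfolding metric_closure_of using y by auto
  qed
  moreover have "countable (\<Union>n. K n)" using K(1) by (simp add: countable_finite)
  moreover have "(\<Union>n. K n) \<subseteq> M" using K(2) by blast
  ultimately show ?thesis unfolding separable_space_def X
    by (metis closure_of_subset_topspace subset_antisym topspace_mtopology)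
qed

lemma zdmc_imp_zdp: "zdmc_space X \<Longrightarrow> zdp_space X"
  unfolding zdmc_space_def zdp_space_def
  using compact_metrizable_imp_separable compact_imp_locally_compact_space
    locally_compact_imp_completely_metrizable_space by blast

lemma zdp_imp_zdms: "zdp_space X \<Longrightarrow> zdms_space X"
  unfolding zdms_space_def zdp_space_def
  using completely_metrizable_imp_metrizable_space by blast

section \<open>Digraphs and graphs on a space\<close>

definition digraph_on :: "'a topology \<Rightarrow> 'a rel \<Rightarrow> bool" where
  "digraph_on X R \<longleftrightarrow> R \<subseteq> topspace X \<times> topspace X \<and> R \<inter> Id_on (topspace X) = {}"

definition graph_on :: "'a topology \<Rightarrow> 'a rel \<Rightarrow> bool" where
  "graph_on X R \<longleftrightarrow> digraph_on X R \<and> sym R"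

definition function_graph :: "'a topology \<Rightarrow> ('a \<Rightarrow> 'a) \<Rightarrow> 'a rel" where
  "function_graph X f = (\<lambda>x. (x, f x)) ` topspace X"

definition induced_graph :: "'a topology \<Rightarrow> ('a \<Rightarrow> 'a) \<Rightarrow> 'a rel" where
  "induced_graph X f = (function_graph X f \<union> (function_graph X f)\<inverse>) - Id_on (topspace X)"

lemma graph_on_induced_graph:
  "f ` topspace X \<subseteq> topspace X \<Longrightarrow> graph_on X (induced_graph X f)"
  unfolding graph_on_def digraph_on_def induced_graph_def function_graph_def
  by (auto simp: sym_def)

section \<open>Continuous chromatic number\<close>

text \<open>
  A cardinal \<open>\<kappa> \<le> \<aleph>\<^sub>0\<close> is an \<^typ>\<open>enat\<close>, with \<^term>\<open>\<infinity>::enat\<close> for \<open>\<aleph>\<^sub>0\<close>, and is identified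
  with its set of predecessors in \<open>\<omega>\<close>. The value \<open>Continuum\<close> stands for \<open>2\<^bsup>\<aleph>\<^sub>0\<^esup>\<close>.
\<close>

definition ordinal_set :: "enat \<Rightarrow> nat set" where
  "ordinal_set \<kappa> = {n. enat n < \<kappa>}"

definition continuous_coloring :: "'a topology \<Rightarrow> 'a rel \<Rightarrow> enat \<Rightarrow> ('a \<Rightarrow> nat) \<Rightarrow> bool" where
  "continuous_coloring X R \<kappa> c \<longleftrightarrow>
     continuous_map X (discrete_topology (ordinal_set \<kappa>)) c \<and> (\<forall>(x, y)\<in>R. c x \<noteq> c y)"

datatype chromatic_value = Countable_Card enat | Continuum

definition ccn :: "'a topology \<Rightarrow> 'a rel \<Rightarrow> chromatic_value" where
  "ccn X R =
     (if \<exists>\<kappa> c. continuous_coloring X R \<kappa> c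
      then Countable_Card (LEAST \<kappa>. \<exists>c. continuous_coloring X R \<kappa> c)
      else Continuum)"

section \<open>The quasi-orders of continuous homomorphism\<close>

definition continuous_hom ::
    "'a topology \<Rightarrow> 'a rel \<Rightarrow> 'b topology \<Rightarrow> 'b rel \<Rightarrow> ('a \<Rightarrow> 'b) \<Rightarrow> bool" where
  "continuous_hom X R Y S \<phi> \<longleftrightarrow>
     continuous_map X Y \<phi> \<and> (\<forall>(x, y)\<in>R. (\<phi> x, \<phi> y) \<in> S)"

definition hom_le :: "'a topology \<times> 'a rel \<Rightarrow> 'b topology \<times> 'b rel \<Rightarrow> bool"
    (infix \<open>\<preceq>\<^sub>c\<close> 50) where
  "XR \<preceq>\<^sub>c YS \<longleftrightarrow> (\<exists>\<phi>. continuous_hom (fst XR) (snd XR) (fst YS) (snd YS) \<phi>)"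

definition inj_hom_le :: "'a topology \<times> 'a rel \<Rightarrow> 'b topology \<times> 'b rel \<Rightarrow> bool"
    (infix \<open>\<preceq>\<^sup>i\<^sub>c\<close> 50) where
  "XR \<preceq>\<^sup>i\<^sub>c YS \<longleftrightarrow>
     (\<exists>\<phi>. continuous_hom (fst XR) (snd XR) (fst YS) (snd YS) \<phi> \<and> inj_on \<phi> (topspace (fst XR)))"

section \<open>The two classes\<close>

text \<open>
  Every 0DMC space is homeomorphic to a closed subspace of the Cantor space, so a class of graphs
  on 0DMC spaces is represented up to isomorphism by spaces whose points are of type
  \<^typ>\<open>nat \<Rightarrow> bool\<close>. The topology on these points is arbitrary.
\<close>

definition homeo_graph_class :: "((nat \<Rightarrow> bool) topology \<times> (nat \<Rightarrow> bool) rel) set" where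
  "homeo_graph_class =
     {(X, G). zdmc_space X \<and> countable (topspace X) \<and>
              (\<exists>f. homeomorphic_map X X f \<and> G = induced_graph X f) \<and>
              ccn X G = Countable_Card 3}"

definition countable_graph_class :: "((nat \<Rightarrow> bool) topology \<times> (nat \<Rightarrow> bool) rel) set" where
  "countable_graph_class =
     {(X, G). zdmc_space X \<and> graph_on X G \<and> countable G \<and> ccn X G = Countable_Card 3}"

end

theory Submission
  imports Defs "HOL-Computational_Algebra.Primes"
begin

text \<open>
  Both embeddings use the same spaces. For a set \<open>Q\<close> of primes, take for each \<open>q \<in> Q\<close> a cycle of
  length \<open>3q\<close>, and let its points converge, as \<open>q\<close> grows, to one of three limit points according to
  their position modulo 3. This space is compact, countable and zero-dimensional, the position
  modulo 3 is a continuous 3-colouring of it, and the shift along the cycles (with the three limit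
  points permuted cyclically) is a homeomorphism. Inclusions of sets of primes give inclusions of
  graphs, so the work lies in the converse: a homomorphism must preserve the lengths of the cycles.

  For injective homomorphisms of the graph induced by the shift, a cycle cannot backtrack, so its
  image runs monotonically around a cycle of length \<open>3r\<close> and closes up after \<open>3q\<close> steps. Hence \<open>r\<close>
  divides \<open>q\<close>; injectivity excludes the limit triangle \<open>r = 1\<close>, and so \<open>r = q\<close>
  (\<open>injective_hom_subset\<close>).

  Without injectivity a 3-colourable graph would collapse to any triangle of the target, so
  the limit triangle has to go. In the second graph its edges are removed, and instead each point of
  colour \<open>i + 1\<close> on a cycle is joined to the limit point of colour \<open>i\<close>, its hub. The edges of the
  cycles still accumulate at the three missing edges. This keeps the continuous chromatic number at
  three. It also forces a continuous homomorphism to permute the hubs, because the hubs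
  form the only triangle in the closure of the graph (\<open>hom_hubs\<close>). Being joined to a hub,
  a point then carries a colour that the homomorphism can only change by this permutation of three
  colours; a permutation of three colours preserves or reverses their cyclic order, and so every
  cycle is again mapped monotonically around a cycle, with the same divisibility conclusion
  (\<open>hub_hom_subset\<close>).

  What remains is to embed the power set of \<open>\<omega>\<close> into the infinite sets of primes. The sets have to
  be infinite because edges of the cycles accumulate at the missing edges between the hubs only if
  there are infinitely many cycles.
\<close>

section \<open>Graphs of continuous chromatic number three\<close>

lemma ccn_eq_threeI:
  assumes three: "continuous_coloring X R 3 c0"
    and spread: "\<And>\<kappa> c. continuous_coloring X R \<kappa> c \<Longrightarrow>
      \<exists>x\<in>topspace X. \<exists>y\<in>topspace X. \<exists>z\<in>topspace X. c x \<noteq> c y \<and> c y \<noteq> c z \<and> c z \<noteq> c x"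
  shows "ccn X R = Countable_Card 3"
proof -
  have "3 \<le> \<kappa>" if c: "continuous_coloring X R \<kappa> c" for \<kappa> c
  proof (rule ccontr)
    assume "\<not> 3 \<le> \<kappa>"
    then have lt: "\<kappa> < 3" by simp
    obtain x y z where xyz: "x \<in> topspace X" "y \<in> topspace X" "z \<in> topspace X"
      and ne: "c x \<noteq> c y" "c y \<noteq> c z" "c z \<noteq> c x"
      using spread[OF c] by blast
    have "c u < 2" if "u \<in> topspace X" for u
    proof -
      have "c u \<in> ordinal_set \<kappa>"
        using c that by (auto simp: continuous_coloring_def continuous_map_def)
      then have "enat (c u) < \<kappa>" by (simp add: ordinal_set_def)
      moreover obtain k where "\<kappa> = enat k" using lt by (cases \<kappa>) auto
      ultimately show ?thesis using lt by (simp add: numeral_eq_enat)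
    qed
    then have "c x < 2" "c y < 2" "c z < 2" using xyz by auto
    then show False using ne by linarith
  qed
  then have "(LEAST \<kappa>. \<exists>c. continuous_coloring X R \<kappa> c) = 3"
    by (intro Least_equality) (use three in auto)
  then show ?thesis unfolding ccn_def using three by auto
qed

section \<open>Cycles converging to three points\<close>

text \<open>
  A point is the singleton that codes a pair of a cycle index and a position. Only the pair matters:
  the topology comes from the metric defined below, not from the product topology.
\<close>

definition node :: "nat \<Rightarrow> nat \<Rightarrow> nat \<Rightarrow> bool" where
  "node q j = (\<lambda>k. k = prod_encode (q, j))"

definition cyc :: "(nat \<Rightarrow> bool) \<Rightarrow> nat" where
  "cyc x = fst (prod_decode (THE k. x k))"

definition pos :: "(nat \<Rightarrow> bool) \<Rightarrow> nat" where
  "pos x = snd (prod_decode (THE k. x k))"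

lemma cyc_node [simp]: "cyc (node q j) = q" and pos_node [simp]: "pos (node q j) = j"
  by (simp_all add: cyc_def pos_def node_def)

lemma node_eq_iff [simp]: "node q j = node q' j' \<longleftrightarrow> q = q' \<and> j = j'"
  by (metis cyc_node pos_node)

text \<open>
  The three limit points are the cycle of index 1. The index is never a prime, and the length \<open>3q\<close> of
  a cycle is then correct for the limit points as well.
\<close>

definition points :: "nat set \<Rightarrow> (nat \<Rightarrow> bool) set" where
  "points Q = {node q j | q j. q \<in> insert 1 Q \<and> j < 3 * q}"

definition colour :: "(nat \<Rightarrow> bool) \<Rightarrow> nat" where
  "colour x = pos x mod 3"

definition shift :: "(nat \<Rightarrow> bool) \<Rightarrow> nat \<Rightarrow> bool" where
  "shift x = node (cyc x) (Suc (pos x) mod (3 * cyc x))"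

lemma node_in_points [simp]: "node q j \<in> points Q \<longleftrightarrow> (q = 1 \<or> q \<in> Q) \<and> j < 3 * q"
  by (auto simp: points_def)

lemma pointsE:
  assumes "x \<in> points Q"
  obtains q j where "x = node q j" "q = 1 \<or> q \<in> Q" "0 < q" "j < 3 * q"
proof -
  obtain q j where "x = node q j" "q \<in> insert 1 Q" "j < 3 * q"
    using assms by (auto simp: points_def)
  then show thesis by (intro that[of q j]) auto
qed

lemma points_mono: "Q \<subseteq> Q' \<Longrightarrow> points Q \<subseteq> points Q'"
  by (auto simp: points_def)

lemma countable_points: "countable (points Q)"
proof (rule countable_subset)
  show "points Q \<subseteq> range (\<lambda>(q, j). node q j)" by (auto simp: points_def)
qed simp

lemma colour_node [simp]: "colour (node q j) = j mod 3"
  by (simp add: colour_def)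

lemma colour_less [simp]: "colour x < 3"
  by (simp add: colour_def)

lemma shift_node [simp]: "shift (node q j) = node q (Suc j mod (3 * q))"
  by (simp add: shift_def)

lemma cyc_shift [simp]: "cyc (shift x) = cyc x"
  by (simp add: shift_def)

lemma colour_shift [simp]: "colour (shift x) = Suc (colour x) mod 3"
  by (simp add: shift_def colour_def mod_mod_cancel mod_Suc_eq)

lemma colour_shift_eq_iff: "colour (shift x) = colour (shift y) \<longleftrightarrow> colour x = colour y"
proof -
  have "a < 3 \<Longrightarrow> b < 3 \<Longrightarrow> Suc a mod 3 = Suc b mod 3 \<longleftrightarrow> a = b" for a b :: nat
    by (auto simp: mod_Suc split: if_splits)
  then show ?thesis by simp
qed

lemma shift_in_points [simp]: "x \<in> points Q \<Longrightarrow> shift x \<in> points Q"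
  by (auto elim!: pointsE)

lemma limit_point_eq_node: "x \<in> points Q \<Longrightarrow> cyc x = 1 \<Longrightarrow> x = node 1 (colour x)"
  by (auto elim!: pointsE)

lemma cyc_pos: "x \<in> points Q \<Longrightarrow> 0 < cyc x"
  by (auto elim!: pointsE)

lemma funpow_shift_node:
  "j < 3 * q \<Longrightarrow> (shift ^^ n) (node q j) = node q ((j + n) mod (3 * q))"
  by (induction n) (simp_all add: mod_Suc_eq)

lemma funpow_shift_in_points: "x \<in> points Q \<Longrightarrow> (shift ^^ n) x \<in> points Q"
  by (induction n) simp_all

lemma funpow_shift_fixes:
  assumes "x \<in> points Q" "(shift ^^ n) x = x"
  shows "3 * cyc x dvd n"
proof -
  obtain q j where x: "x = node q j" and j: "j < 3 * q"
    using assms(1) by (rule pointsE)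
  then have "(j + n) mod (3 * q) = (j + 0) mod (3 * q)"
    using assms(2) by (simp add: funpow_shift_node)
  then show ?thesis
    using x by (metis add_diff_cancel_left cyc_node diff_zero le_add1 mod_eq_dvd_iff_nat add_0_right)
qed

lemma funpow_shift_return:
  assumes "x \<in> points Q"
  shows "(shift ^^ (3 * cyc x)) x = x"
  using assms by (auto elim!: pointsE simp: funpow_shift_node)

lemma shift_neq: "x \<in> points Q \<Longrightarrow> shift x \<noteq> x"
  using funpow_shift_fixes[of x Q 1] cyc_pos[of x Q] by auto

lemma inj_on_shift: "inj_on shift (points Q)"
proof (rule inj_onI)
  fix x y assume x: "x \<in> points Q" and y: "y \<in> points Q" and eq: "shift x = shift y"
  have q: "cyc x = cyc y" using eq by (metis cyc_shift)
  obtain m where m: "3 * cyc x = Suc m"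
    using cyc_pos[OF x] by (cases "3 * cyc x") auto
  have "(shift ^^ Suc m) x = (shift ^^ Suc m) y"
    using eq by (simp only: funpow_Suc_right o_apply)
  then show "x = y"
    using funpow_shift_return[OF x] funpow_shift_return[OF y] m q by metis
qed

lemma shift_image: "shift ` points Q = points Q"
proof
  show "points Q \<subseteq> shift ` points Q"
  proof
    fix x assume x: "x \<in> points Q"
    obtain m where m: "3 * cyc x = Suc m"
      using cyc_pos[OF x] by (cases "3 * cyc x") auto
    then have "x = shift ((shift ^^ m) x)"
      using funpow_shift_return[OF x] by simp
    then show "x \<in> shift ` points Q" using funpow_shift_in_points[OF x] by blast
  qed
qed auto

lemma cyc_funpow_shift [simp]: "cyc ((shift ^^ n) x) = cyc x"
  by (induction n) simp_all

lemma monotone_walk_funpow: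
  assumes "(\<forall>k. u (Suc k) = shift (u k)) \<or> (\<forall>k. u k = shift (u (Suc k)))"
  shows "(shift ^^ n) (u 0) = u n \<or> (shift ^^ n) (u n) = u 0"
  using assms
proof (rule disj_forward)
  assume *: "\<forall>k. u (Suc k) = shift (u k)"
  show "(shift ^^ n) (u 0) = u n" by (induction n) (simp_all add: *)
next
  assume *: "\<forall>k. u k = shift (u (Suc k))"
  show "(shift ^^ n) (u n) = u 0"
  proof (induction n)
    case (Suc n)
    have "(shift ^^ Suc n) (u (Suc n)) = (shift ^^ n) (shift (u (Suc n)))"
      by (simp only: funpow_Suc_right o_apply)
    also have "\<dots> = (shift ^^ n) (u n)" using *[rule_format, of n] by (rule arg_cong[OF sym])
    finally show ?case using Suc by simp
  qed simp
qed

text \<open>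
  The divisibility that separates the cycles: a closed walk that always moves in one direction goes
  around its cycle a whole number of times.
\<close>

lemma monotone_walk_cyc_dvd:
  assumes "u 0 \<in> points Q"
    and "(\<forall>k. u (Suc k) = shift (u k)) \<or> (\<forall>k. u k = shift (u (Suc k)))"
    and ret: "u n = u 0"
  shows "3 * cyc (u 0) dvd n"
proof -
  have "(shift ^^ n) (u 0) = u 0"
    using monotone_walk_funpow[OF assms(2), of n] ret by auto
  then show ?thesis using funpow_shift_fixes assms(1) by blast
qed

definition weight :: "(nat \<Rightarrow> bool) \<Rightarrow> real" where
  "weight x = (if cyc x = 1 then 0 else 1 / real (cyc x))"

text \<open>
  Two points of one colour are as far apart as the heavier of them is from the limit point of that
  colour, which makes this an ultrametric. Limit points have weight 0.
\<close>

definition sep :: "(nat \<Rightarrow> bool) \<Rightarrow> (nat \<Rightarrow> bool) \<Rightarrow> real" where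
  "sep x y = (if x = y then 0 else if colour x \<noteq> colour y then 1 else max (weight x) (weight y))"

lemma weight_bounds: "0 \<le> weight x" "weight x \<le> 1"
  by (auto simp: weight_def divide_le_eq)

lemma sep_ultrametric: "sep x z \<le> max (sep x y) (sep y z)"
  using weight_bounds[of x] weight_bounds[of y] weight_bounds[of z]
  by (auto simp: sep_def)

lemma sep_nonneg: "0 \<le> sep x y"
  using weight_bounds[of x] by (auto simp: sep_def max_def)

lemma sep_commute: "sep x y = sep y x"
  by (auto simp: sep_def)

interpretation cycles: Metric_space "points Q" sep for Q
proof
  fix x y z
  show "0 \<le> sep x y" "sep x y = sep y x" by (fact sep_nonneg sep_commute)+
  show "sep x z \<le> sep x y + sep y z"
    using sep_ultrametric[of x z y] sep_nonneg[of x y] sep_nonneg[of y z] by linarith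
  assume x: "x \<in> points Q" and y: "y \<in> points Q"
  show "sep x y = 0 \<longleftrightarrow> x = y"
  proof
    assume 0: "sep x y = 0"
    show "x = y"
    proof (rule ccontr)
      assume ne: "x \<noteq> y"
      then have col: "colour x = colour y" and "max (weight x) (weight y) = 0"
        using 0 by (auto simp: sep_def split: if_splits)
      then have "weight x = 0" "weight y = 0"
        using weight_bounds[of x] weight_bounds[of y] by linarith+
      then have "cyc x = 1" "cyc y = 1"
        using cyc_pos[OF x] cyc_pos[OF y] by (auto simp: weight_def split: if_splits)
      then show False
        using ne col limit_point_eq_node x y by metis
    qed
  qed (simp add: sep_def)
qed

definition cycle_space :: "nat set \<Rightarrow> (nat \<Rightarrow> bool) topology" where
  "cycle_space Q = cycles.mtopology Q"

lemma topspace_cycle_space [simp]: "topspace (cycle_space Q) = points Q"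
  by (simp add: cycle_space_def)

text \<open>
  The radius \<open>1 / q\<close> isolates a point on a cycle of length \<open>3q\<close>; around a limit point it is the radius
  1 and still confines the colour.
\<close>

lemma near_point:
  assumes "sep a x < 1 / real (cyc a)"
  shows "colour x = colour a" "cyc a \<noteq> 1 \<Longrightarrow> x = a"
proof -
  have "1 / real (cyc a) \<le> 1" by (simp add: divide_le_eq)
  then show "colour x = colour a" using assms by (auto simp: sep_def split: if_splits)
  show "x = a" if "cyc a \<noteq> 1"
  proof -
    have "weight a = 1 / real (cyc a)" using that by (simp add: weight_def)
    then show ?thesis using assms \<open>1 / real (cyc a) \<le> 1\<close>
      by (auto simp: sep_def split: if_splits)
  qed
qed

text \<open>
  Convergence of the cycles to the limit points, for three prescribed neighbourhoods at once. It
  yields compactness, the lower bound on colourings and the control of continuous homomorphisms.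
\<close>

lemma tail_in_neighbourhoods:
  assumes U: "\<And>i. i < 3 \<Longrightarrow> openin (cycle_space Q) (U i) \<and> node 1 i \<in> U i"
  obtains N where "\<And>x. x \<in> points Q \<Longrightarrow> N \<le> cyc x \<Longrightarrow> x \<in> U (colour x)"
proof -
  have "\<exists>r>0. cycles.mball Q (node 1 i) r \<subseteq> U i" if "i < 3" for i
    using U[OF that] by (simp add: cycle_space_def cycles.openin_mtopology)
  then obtain r where r: "\<And>i. i < 3 \<Longrightarrow> r i > 0" "\<And>i. i < 3 \<Longrightarrow> cycles.mball Q (node 1 i) (r i) \<subseteq> U i"
    by metis
  define \<delta> where "\<delta> = Min (r ` {..<3})"
  have \<delta>: "\<delta> > 0" "\<And>i. i < 3 \<Longrightarrow> \<delta> \<le> r i" using r(1)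
    by (auto simp: \<delta>_def Min_gr_iff lessThan_empty_iff)
  obtain N where N: "inverse (real (Suc N)) < \<delta>" using reals_Archimedean[OF \<delta>(1)] by blast
  show thesis
  proof
    fix x assume x: "x \<in> points Q" and "Suc N \<le> cyc x"
    then have "1 / real (cyc x) \<le> inverse (real (Suc N))"
      by (simp add: field_simps)
    then have "sep (node 1 (colour x)) x < \<delta>"
      using N \<delta>(1) by (auto simp: sep_def weight_def)
    then have "x \<in> cycles.mball Q (node 1 (colour x)) (r (colour x))"
      using x \<delta>(2)[OF colour_less[of x]] by auto
    then show "x \<in> U (colour x)" using r(2)[of "colour x"] by auto
  qed
qed

lemma finite_points_below: "finite {x \<in> points Q. cyc x < N}"
proof (rule finite_subset)
  show "{x \<in> points Q. cyc x < N} \<subseteq> (\<lambda>(q, j). node q j) ` ({..<N} \<times> {..<3 * N})"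
    by (force elim!: pointsE)
qed simp

lemma compact_cycle_space: "compact_space (cycle_space Q)"
  unfolding compact_space_alt
proof (intro allI impI, elim conjE)
  fix \<U> assume op: "\<forall>U\<in>\<U>. openin (cycle_space Q) U" and cov: "topspace (cycle_space Q) \<subseteq> \<Union>\<U>"
  obtain V where V: "\<And>x. x \<in> points Q \<Longrightarrow> V x \<in> \<U> \<and> x \<in> V x"
  proof -
    have "\<forall>x\<in>points Q. \<exists>U. U \<in> \<U> \<and> x \<in> U" using cov by auto
    from bchoice[OF this] show thesis using that by blast
  qed
  have "openin (cycle_space Q) (V (node 1 i)) \<and> node 1 i \<in> V (node 1 i)" if "i < 3" for i
    using V[of "node 1 i"] op that by simp
  from tail_in_neighbourhoods[OF this]
  obtain N where N: "\<And>x. x \<in> points Q \<Longrightarrow> N \<le> cyc x \<Longrightarrow> x \<in> V (node 1 (colour x))"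
    by blast
  \<comment> \<open>The tails of the three colours are covered by three sets, the rest is finite.\<close>
  let ?F = "V ` ({x \<in> points Q. cyc x < N} \<union> node 1 ` {..<3})"
  have "points Q \<subseteq> \<Union>?F"
  proof
    fix x assume x: "x \<in> points Q"
    show "x \<in> \<Union>?F"
    proof (cases "cyc x < N")
      case True then show ?thesis using V x by auto
    next
      case False
      then have "x \<in> V (node 1 (colour x))" using N x by simp
      moreover have "node 1 (colour x) \<in> node 1 ` {..<3}" by simp
      ultimately show ?thesis by blast
    qed
  qed
  moreover have "?F \<subseteq> \<U>" using V by auto
  ultimately show "\<exists>\<F>. finite \<F> \<and> \<F> \<subseteq> \<U> \<and> topspace (cycle_space Q) \<subseteq> \<Union>\<F>"
    using finite_points_below[of Q N] by (intro exI[of _ ?F]) simp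
qed

text \<open>
  Balls of an ultrametric are closed as well as open.
\<close>

lemma zero_dimensional_cycle_space: "zero_dimensional (cycle_space Q)"
  unfolding zero_dimensional_def
proof (intro exI[of _ "{cycles.mball Q x r | x r. r > 0}"] conjI ballI allI impI)
  fix V assume "V \<in> {cycles.mball Q x r | x r. r > 0}"
  then obtain x r where V: "V = cycles.mball Q x r" and r: "r > 0" by blast
  show "openin (cycle_space Q) V" by (simp add: V cycle_space_def)
  have "openin (cycle_space Q) (points Q - V)"
    unfolding cycle_space_def cycles.openin_mtopology
  proof (intro conjI allI impI)
    fix y assume y: "y \<in> points Q - V"
    have "cycles.mball Q y r \<subseteq> points Q - V"
    proof
      fix z assume z: "z \<in> cycles.mball Q y r"
      have "z \<notin> V"
      proof
        assume "z \<in> V"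
        then have "sep x y < r"
          using z V sep_ultrametric[of x y z] by (auto simp: sep_commute)
        with \<open>z \<in> V\<close> y V show False by auto
      qed
      then show "z \<in> points Q - V" using z by auto
    qed
    then show "\<exists>r>0. cycles.mball Q y r \<subseteq> points Q - V" using r by blast
  qed auto
  then show "closedin (cycle_space Q) V" by (auto simp: closedin_def V)
next
  fix U x assume "openin (cycle_space Q) U \<and> x \<in> U"
  then obtain r where r: "r > 0" "cycles.mball Q x r \<subseteq> U" and x: "x \<in> points Q"
    unfolding cycle_space_def cycles.openin_mtopology by blast
  then show "\<exists>V\<in>{cycles.mball Q x r | x r. r > 0}. x \<in> V \<and> V \<subseteq> U"
    by (intro bexI[of _ "cycles.mball Q x r"]) auto
qed

lemma zdmc_cycle_space: "zdmc_space (cycle_space Q)"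
  using zero_dimensional_cycle_space compact_cycle_space
  by (auto simp: zdmc_space_def cycle_space_def cycles.metrizable_space_mtopology)

lemma continuous_colour: "continuous_map (cycle_space Q) (discrete_topology (ordinal_set 3)) colour"
  unfolding cycle_space_def cycles.continuous_map_from_metric
proof (intro conjI ballI allI impI)
  show "colour \<in> points Q \<rightarrow> topspace (discrete_topology (ordinal_set 3))"
    by (auto simp: ordinal_set_def numeral_eq_enat)
  fix a U assume a: "a \<in> points Q" and "openin (discrete_topology (ordinal_set 3)) U \<and> colour a \<in> U"
  then have "colour x \<in> U" if "sep a x < 1 / real (cyc a)" for x
    using near_point(1)[OF that] by simp
  then show "\<exists>r>0. \<forall>x. x \<in> points Q \<and> sep a x < r \<longrightarrow> colour x \<in> U"
    using cyc_pos[OF a] by (intro exI[of _ "1 / real (cyc a)"]) simp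
qed

lemma continuous_inclusion:
  assumes "Q \<subseteq> Q'"
  shows "continuous_map (cycle_space Q) (cycle_space Q') (\<lambda>x. x)"
  unfolding cycle_space_def
  by (subst cycles.metric_continuous_map[OF cycles.Metric_space_axioms])
     (use points_mono[OF assms] in auto)

lemma homeomorphic_shift: "homeomorphic_map (cycle_space Q) (cycle_space Q) shift"
proof -
  interpret Metric_space12 "points Q" sep "points Q" sep
    by (simp add: Metric_space12_def cycles.Metric_space_axioms)
  have "sep (shift x) (shift y) = sep x y" if "x \<in> points Q" "y \<in> points Q" for x y
  proof -
    have "shift x = shift y \<longleftrightarrow> x = y" using inj_on_shift[of Q] that by (auto dest: inj_onD)
    moreover have "weight (shift z) = weight z" for z by (simp add: weight_def)
    ultimately show ?thesis by (simp only: sep_def colour_shift_eq_iff)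
  qed
  then show ?thesis
    unfolding cycle_space_def by (intro isometry_imp_homeomorphic_map shift_image)
qed

section \<open>Cycle lengths are preserved by injective homomorphisms\<close>

definition cycle_graph :: "nat set \<Rightarrow> (nat \<Rightarrow> bool) rel" where
  "cycle_graph Q = induced_graph (cycle_space Q) shift"

lemma cycle_graph_iff:
  "(x, y) \<in> cycle_graph Q \<longleftrightarrow> x \<in> points Q \<and> y \<in> points Q \<and> (y = shift x \<or> x = shift y)"
  by (auto simp: cycle_graph_def induced_graph_def function_graph_def dest: shift_neq)

lemma cycle_graph_in_class: "(cycle_space Q, cycle_graph Q) \<in> homeo_graph_class"
proof -
  have "ccn (cycle_space Q) (cycle_graph Q) = Countable_Card 3"
  proof (rule ccn_eq_threeI)
    have "colour (shift x) \<noteq> colour x" for x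
      using colour_less[of x] by (simp add: mod_Suc)
    then show "continuous_coloring (cycle_space Q) (cycle_graph Q) 3 colour"
      using continuous_colour by (force simp: continuous_coloring_def cycle_graph_iff)
    fix \<kappa> c assume c: "continuous_coloring (cycle_space Q) (cycle_graph Q) \<kappa> c"
    have "c x \<noteq> c (shift x)" if "x \<in> points Q" for x
      using c that by (fastforce simp: continuous_coloring_def cycle_graph_iff)
    from this[of "node 1 0"] this[of "node 1 1"] this[of "node 1 2"]
    show "\<exists>x\<in>topspace (cycle_space Q). \<exists>y\<in>topspace (cycle_space Q). \<exists>z\<in>topspace (cycle_space Q).
        c x \<noteq> c y \<and> c y \<noteq> c z \<and> c z \<noteq> c x"
      by (intro bexI[of _ "node 1 0"] bexI[of _ "node 1 1"] bexI[of _ "node 1 2"])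
        (auto simp: numeral_2_eq_2)
  qed
  then show ?thesis
    using zdmc_cycle_space countable_points homeomorphic_shift
    by (auto simp: homeo_graph_class_def cycle_graph_def)
qed

text \<open>
  Every point has the two neighbours \<open>shift x\<close> and its preimage, so a walk that never returns
  to the point before the last one keeps its first direction.
\<close>

lemma nonbacktracking_walk_monotone:
  assumes in_pts: "\<And>k. u k \<in> points Q"
    and edge: "\<And>k. u (Suc k) = shift (u k) \<or> u k = shift (u (Suc k))"
    and nb: "\<And>k. u (Suc (Suc k)) \<noteq> u k"
  shows "(\<forall>k. u (Suc k) = shift (u k)) \<or> (\<forall>k. u k = shift (u (Suc k)))"
proof -
  have inj: "x = y" if "shift x = shift y" "x \<in> points Q" "y \<in> points Q" for x y
    using inj_on_shift that by (blast dest: inj_onD)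
  have "u (Suc k) = shift (u k)" if "u (Suc 0) = shift (u 0)" for k
    by (induction k) (use that edge nb inj in_pts in metis)+
  moreover have "u k = shift (u (Suc k))" if "u 0 = shift (u (Suc 0))" for k
    by (induction k) (use that edge nb inj in_pts in metis)+
  ultimately show ?thesis using edge[of 0] by blast
qed

text \<open>
  The cycle of length \<open>3q\<close> is mapped around a cycle of length \<open>3r\<close> with \<open>r\<close> dividing the prime \<open>q\<close>.
  If \<open>r\<close> were 1, the image would have only three points, which contradicts injectivity.
\<close>

lemma injective_hom_subset:
  assumes prime: "\<And>q. q \<in> Q \<union> Q' \<Longrightarrow> prime q"
    and hom: "(cycle_space Q, cycle_graph Q) \<preceq>\<^sup>i\<^sub>c (cycle_space Q', cycle_graph Q')"
  shows "Q \<subseteq> Q'"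
proof
  fix q assume q: "q \<in> Q"
  then have q2: "2 \<le> q" using prime prime_ge_2_nat by blast
  obtain \<phi> where \<phi>: "continuous_hom (cycle_space Q) (cycle_graph Q) (cycle_space Q') (cycle_graph Q') \<phi>"
    and inj: "inj_on \<phi> (points Q)"
    using hom by (auto simp: inj_hom_le_def)
  define v where "v k = (shift ^^ k) (node q 0)" for k
  define u where "u k = \<phi> (v k)" for k
  have v: "v k = node q (k mod (3 * q))" for k using q2 by (simp add: v_def funpow_shift_node)
  have vpts: "v k \<in> points Q" for k using q q2 by (simp add: v)
  have "(v k, v (Suc k)) \<in> cycle_graph Q" for k
    using vpts[of k] vpts[of "Suc k"] by (simp add: cycle_graph_iff v_def)
  then have edge: "(u k, u (Suc k)) \<in> cycle_graph Q'" for k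
    using \<phi> unfolding continuous_hom_def u_def by blast
  \<comment> \<open>A cycle of length \<open>3q\<close> has at least six points, which covers the gaps 2 and 3 used below.\<close>
  have u_inj: "u k \<noteq> u l" if "k < l" "l < k + 6" for k l
  proof
    assume "u k = u l"
    then have "v k = v l" using inj vpts by (simp add: u_def inj_on_eq_iff)
    then have "k mod (3 * q) = l mod (3 * q)" by (simp add: v)
    then have "3 * q dvd l - k" using that by (metis less_imp_le_nat mod_eq_dvd_iff_nat)
    then have "3 * q \<le> l - k" using that by (simp add: dvd_imp_le)
    then show False using that q2 by linarith
  qed
  have upts: "u k \<in> points Q'" for k using edge[of k] by (simp add: cycle_graph_iff)
  have mono: "(\<forall>k. u (Suc k) = shift (u k)) \<or> (\<forall>k. u k = shift (u (Suc k)))"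
  proof (rule nonbacktracking_walk_monotone)
    show "u k \<in> points Q'" for k by (fact upts)
    show "u (Suc k) = shift (u k) \<or> u k = shift (u (Suc k))" for k
      using edge[of k] by (auto simp: cycle_graph_iff)
    show "u (Suc (Suc k)) \<noteq> u k" for k using u_inj[of k "Suc (Suc k)"] by auto
  qed
  let ?r = "cyc (u 0)"
  have "u (3 * q) = u 0" by (simp add: u_def v)
  from monotone_walk_cyc_dvd[OF upts mono this] have "?r dvd q" by simp
  moreover have "?r \<noteq> 1"
  proof
    assume r: "?r = 1"
    from monotone_walk_funpow[OF mono, of 3] have "u 3 = u 0"
    proof
      assume "(shift ^^ 3) (u 0) = u 3"
      then show ?thesis using funpow_shift_return[OF upts, of 0] r by simp
    next
      assume *: "(shift ^^ 3) (u 3) = u 0"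
      then have "cyc (u 3) = 1" using r by (metis cyc_funpow_shift)
      then show ?thesis using funpow_shift_return[OF upts, of 3] * by simp
    qed
    then show False using u_inj[of 0 3] by simp
  qed
  ultimately have "?r = q" using prime q by (auto simp: prime_nat_iff)
  then show "q \<in> Q'" using upts[of 0] \<open>?r \<noteq> 1\<close> by (auto elim!: pointsE)
qed

section \<open>Cycles anchored at three hubs\<close>

text \<open>
  Every edge is oriented so that the colour increases by one. The relation \<open>arcs\<close> contains the arcs
  between limit points, which for infinite \<open>Q\<close> are limits of arcs in \<open>hub_arcs\<close> without belonging to
  that relation. In
  \<open>arcs\<close> a point on a cycle has its shift as its only successor; the other arcs start at limit points.
\<close>

definition arcs :: "nat set \<Rightarrow> (nat \<Rightarrow> bool) rel" where
  "arcs Q = {(x, y). x \<in> points Q \<and> y \<in> points Q \<and>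
     colour y = Suc (colour x) mod 3 \<and> (cyc x = 1 \<or> y = shift x)}"

definition hub_arcs :: "nat set \<Rightarrow> (nat \<Rightarrow> bool) rel" where
  "hub_arcs Q = {(x, y) \<in> arcs Q. cyc y \<noteq> 1}"

definition hub_graph :: "nat set \<Rightarrow> (nat \<Rightarrow> bool) rel" where
  "hub_graph Q = hub_arcs Q \<union> (hub_arcs Q)\<inverse>"

lemma arcs_colour: "(x, y) \<in> arcs Q \<Longrightarrow> colour y = Suc (colour x) mod 3"
  by (simp add: arcs_def)

lemma hub_graph_colour:
  assumes "(x, y) \<in> hub_graph Q"
  shows "colour x \<noteq> colour y"
proof -
  have "a < 3 \<Longrightarrow> Suc a mod 3 \<noteq> a" for a by (simp add: mod_Suc)
  moreover have "colour y = Suc (colour x) mod 3 \<or> colour x = Suc (colour y) mod 3"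
    using assms arcs_colour unfolding hub_graph_def hub_arcs_def by blast
  ultimately show ?thesis by (metis colour_less)
qed

lemma hub_graph_mono: "Q \<subseteq> Q' \<Longrightarrow> hub_graph Q \<subseteq> hub_graph Q'"
  using points_mono[of Q Q'] by (auto simp: hub_graph_def hub_arcs_def arcs_def)

lemma shift_hub_arc:
  "x \<in> points Q \<Longrightarrow> cyc x \<noteq> 1 \<Longrightarrow> (x, shift x) \<in> hub_arcs Q"
  by (simp add: hub_arcs_def arcs_def)

lemma hub_arc:
  assumes "x \<in> points Q" "cyc x \<noteq> 1"
  shows "(node 1 ((colour x + 2) mod 3), x) \<in> hub_arcs Q"
proof -
  have "Suc ((colour x + 2) mod 3) mod 3 = colour x" by (simp add: mod_Suc_eq)
  then show ?thesis using assms by (simp add: hub_arcs_def arcs_def)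
qed

lemma cycle_arc_near_hubs:
  assumes U: "\<And>i. i < 3 \<Longrightarrow> openin (cycle_space Q) (U i) \<and> node 1 i \<in> U i"
    and inf: "infinite Q"
  obtains q where "q \<in> Q" "2 \<le> q" "\<And>j. j < 3 * q \<Longrightarrow> node q j \<in> U (j mod 3)"
proof -
  obtain N where N: "\<And>x. x \<in> points Q \<Longrightarrow> N \<le> cyc x \<Longrightarrow> x \<in> U (colour x)"
    using tail_in_neighbourhoods[OF U] by blast
  obtain q where q: "q \<in> Q" "max N 2 \<le> q"
    using inf unfolding infinite_nat_iff_unbounded_le by blast
  show thesis
  proof
    show "node q j \<in> U (j mod 3)" if "j < 3 * q" for j
      using N[of "node q j"] q that by simp
  qed (use q in auto)
qed

text \<open>
  Two colours do not suffice: on a long cycle a continuous colouring takes its values at the hubs,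
  and the edges of that cycle show that these values are pairwise distinct.
\<close>

lemma hub_graph_in_class:
  assumes "infinite Q"
  shows "(cycle_space Q, hub_graph Q) \<in> countable_graph_class"
proof -
  have "ccn (cycle_space Q) (hub_graph Q) = Countable_Card 3"
  proof (rule ccn_eq_threeI)
    show "continuous_coloring (cycle_space Q) (hub_graph Q) 3 colour"
      unfolding continuous_coloring_def
      using continuous_colour hub_graph_colour by blast
    fix \<kappa> c assume c: "continuous_coloring (cycle_space Q) (hub_graph Q) \<kappa> c"
    then have cont: "continuous_map (cycle_space Q) (discrete_topology (ordinal_set \<kappa>)) c"
      by (simp add: continuous_coloring_def)
    define U where "U i = {x \<in> points Q. c x = c (node 1 i)}" for i
    have "openin (cycle_space Q) (U i) \<and> node 1 i \<in> U i" if "i < 3" for i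
    proof
      have "c (node 1 i) \<in> ordinal_set \<kappa>"
        using cont that by (auto simp: continuous_map_def)
      then show "openin (cycle_space Q) (U i)"
        using openin_continuous_map_preimage[OF cont, of "{c (node 1 i)}"] by (simp add: U_def)
      show "node 1 i \<in> U i" using that by (simp add: U_def)
    qed
    then obtain q where q: "q \<in> Q" "2 \<le> q" "\<And>j. j < 3 * q \<Longrightarrow> node q j \<in> U (j mod 3)"
      using cycle_arc_near_hubs[OF _ assms] by blast
    have cq: "c (node q j) = c (node 1 (j mod 3))" if "j < 3 * q" for j
      using q(3)[OF that] by (simp add: U_def)
    have ne: "c (node q j) \<noteq> c (node q (Suc j))" if "Suc j < 3 * q" for j
    proof -
      have "(node q j, node q (Suc j)) \<in> hub_graph Q"
        using shift_hub_arc[of "node q j" Q] q that by (simp add: hub_graph_def)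
      then show ?thesis using c unfolding continuous_coloring_def by blast
    qed
    have bounds: "0 < 3 * q" "1 < 3 * q" "2 < 3 * q" "3 < 3 * q"
      using q(2) by linarith+
    have "c (node q 0) = c (node 1 0)" "c (node q 1) = c (node 1 1)"
      "c (node q 2) = c (node 1 2)" "c (node q 3) = c (node 1 0)"
      using bounds[THEN cq] by simp_all
    moreover have "c (node q 0) \<noteq> c (node q 1)" "c (node q 1) \<noteq> c (node q 2)" "c (node q 2) \<noteq> c (node q 3)"
      using ne[of 0] ne[of 1] ne[of 2] bounds
      by (simp_all only: One_nat_def numeral_2_eq_2 numeral_3_eq_3 not_False_eq_True)
    ultimately have "c (node 1 0) \<noteq> c (node 1 1)" "c (node 1 1) \<noteq> c (node 1 2)" "c (node 1 2) \<noteq> c (node 1 0)"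
      by metis+
    then show "\<exists>x\<in>topspace (cycle_space Q). \<exists>y\<in>topspace (cycle_space Q). \<exists>z\<in>topspace (cycle_space Q).
        c x \<noteq> c y \<and> c y \<noteq> c z \<and> c z \<noteq> c x"
      by (intro bexI[of _ "node 1 0"] bexI[of _ "node 1 1"] bexI[of _ "node 1 2"])
        simp_all
  qed
  moreover have "hub_graph Q \<subseteq> points Q \<times> points Q"
    by (auto simp: hub_graph_def hub_arcs_def arcs_def)
  moreover have "hub_graph Q \<inter> Id_on (points Q) = {}"
    using hub_graph_colour by blast
  moreover have "sym (hub_graph Q)" by (auto simp: hub_graph_def sym_def)
  moreover have "countable (points Q \<times> points Q)"
    by (intro countable_SIGMA countable_points)
  ultimately show ?thesis
    using zdmc_cycle_space[of Q] countable_subset[of "hub_graph Q" "points Q \<times> points Q"]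
    by (simp add: countable_graph_class_def graph_on_def digraph_on_def)
qed

text \<open>
  The closure of \<open>hub_arcs\<close> is contained in \<open>arcs\<close>, in a quantitative form. If \<open>a\<close> lies on a cycle,
  the arc near \<open>(a, b)\<close> starts at \<open>a\<close> itself and ends at the shift of \<open>a\<close>, which is too heavy to be near
  to any point other than itself.
\<close>

lemma limit_of_hub_arcs:
  assumes "(x, y) \<in> hub_arcs Q" and a: "a \<in> points Q" and b: "b \<in> points Q"
    and near: "sep a x < min (1 / real (cyc a)) (1 / real (cyc b))"
      "sep b y < min (1 / real (cyc a)) (1 / real (cyc b))"
  shows "(a, b) \<in> arcs Q"
proof -
  have nx: "sep a x < 1 / real (cyc a)" and ny: "sep b y < 1 / real (cyc b)" "sep b y < 1 / real (cyc a)"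
    using near by simp_all
  have "(x, y) \<in> arcs Q" using assms(1) by (simp add: hub_arcs_def)
  then have col: "colour b = Suc (colour a) mod 3"
    using arcs_colour near_point(1)[OF nx] near_point(1)[OF ny(1)] by metis
  have "b = shift a" if "cyc a \<noteq> 1"
  proof -
    have "x = a" using near_point(2)[OF nx that] .
    then have y: "y = shift a" using \<open>(x, y) \<in> arcs Q\<close> that by (auto simp: arcs_def)
    then have "weight y = 1 / real (cyc a)" using that by (simp add: weight_def)
    moreover have "colour y = colour b" using near_point(1)[OF ny(1)] .
    ultimately show ?thesis using ny(2) y by (auto simp: sep_def split: if_splits)
  qed
  then show ?thesis using col a b by (auto simp: arcs_def)
qed

text \<open>
  A point on a cycle has only its shift as a successor, so an oriented triangle through it would
  close the cycle after three steps.
\<close>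

lemma arcs_triangle_limit:
  assumes "(a, b) \<in> arcs Q" "(b, c) \<in> arcs Q" "(c, a) \<in> arcs Q"
  shows "cyc a = 1"
proof (rule ccontr)
  assume "cyc a \<noteq> 1"
  then have "b = shift a" "c = shift b" "a = shift c"
    using assms by (auto simp: arcs_def)
  then have "(shift ^^ 3) a = a" by (simp add: numeral_3_eq_3)
  moreover have "a \<in> points Q" using assms(1) by (simp add: arcs_def)
  ultimately have "3 * cyc a dvd 3 * 1" using funpow_shift_fixes[of a Q 3] by simp
  then show False using \<open>cyc a \<noteq> 1\<close> unfolding nat_mult_dvd_cancel_disj by simp
qed

text \<open>
  Colours increase by one along each arc, so a transitive triangle is impossible.
\<close>

lemma arcs_triangle_oriented:
  assumes ab: "(a, b) \<in> arcs Q \<or> (b, a) \<in> arcs Q"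
    and bc: "(b, c) \<in> arcs Q \<or> (c, b) \<in> arcs Q"
    and ca: "(c, a) \<in> arcs Q \<or> (a, c) \<in> arcs Q"
  shows "(a, b) \<in> arcs Q \<and> (b, c) \<in> arcs Q \<and> (c, a) \<in> arcs Q \<or>
         (b, a) \<in> arcs Q \<and> (c, b) \<in> arcs Q \<and> (a, c) \<in> arcs Q"
proof -
  have "a < 3 \<Longrightarrow> Suc (Suc a mod 3) mod 3 \<noteq> Suc a mod 3" for a by (auto simp: mod_Suc)
  then have no: "\<not> ((x, y) \<in> arcs Q \<and> (y, z) \<in> arcs Q \<and> (x, z) \<in> arcs Q)" for x y z
    by (metis arcs_colour colour_less)
  show ?thesis using ab bc ca no by blast
qed

lemma less_3_cases: "i < 3 \<Longrightarrow> i = 0 \<or> i = 1 \<or> i = (2::nat)"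
  by linarith

text \<open>
  The images of points on a long cycle are close to the images of the hubs of their colours and are
  adjacent in cyclic order. Hence the images of the three hubs form a triangle in the
  closure of the target graph, which consists of hubs. Its orientation tells whether the cyclic order
  of the colours is preserved or reversed.
\<close>

lemma hom_hubs:
  assumes inf: "infinite Q"
    and hom: "continuous_hom (cycle_space Q) (hub_graph Q) (cycle_space Q') (hub_graph Q') \<phi>"
  shows "\<forall>i<3. cyc (\<phi> (node 1 i)) = 1"
    and "(\<forall>i<3. colour (\<phi> (node 1 (Suc i mod 3))) = Suc (colour (\<phi> (node 1 i))) mod 3) \<or>
         (\<forall>i<3. colour (\<phi> (node 1 i)) = Suc (colour (\<phi> (node 1 (Suc i mod 3)))) mod 3)"
proof -
  have cont: "continuous_map (cycle_space Q) (cycle_space Q') \<phi>"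
    using hom by (simp add: continuous_hom_def)
  define p where "p i = \<phi> (node 1 i)" for i
  have p: "p i \<in> points Q'" if "i < 3" for i
    using cont that by (auto simp: continuous_map_def p_def)
  \<comment> \<open>The radius at which \<open>limit_of_hub_arcs\<close> applies to each pair of images of hubs.\<close>
  define \<delta> where "\<delta> = Min ((\<lambda>i. 1 / real (cyc (p i))) ` {..<3})"
  have \<delta>: "\<delta> > 0" "\<And>i. i < 3 \<Longrightarrow> \<delta> \<le> 1 / real (cyc (p i))"
    using cyc_pos[OF p] by (auto simp: \<delta>_def Min_gr_iff lessThan_empty_iff)
  define U where "U i = {x \<in> points Q. \<phi> x \<in> cycles.mball Q' (p i) \<delta>}" for i
  have "openin (cycle_space Q) (U i) \<and> node 1 i \<in> U i" if "i < 3" for i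
  proof
    show "openin (cycle_space Q) (U i)"
      using openin_continuous_map_preimage[OF cont, of "cycles.mball Q' (p i) \<delta>"]
      by (simp add: U_def cycle_space_def)
    show "node 1 i \<in> U i" using p[OF that] that \<delta>(1) by (simp add: U_def p_def)
  qed
  then obtain q where q: "q \<in> Q" "2 \<le> q" "\<And>j. j < 3 * q \<Longrightarrow> node q j \<in> U (j mod 3)"
    using cycle_arc_near_hubs[OF _ inf] by blast
  have near: "sep (p (j mod 3)) (\<phi> (node q j)) < \<delta>" if "j < 3 * q" for j
    using q(3)[OF that] by (simp add: U_def)
  have adj: "(p i, p (Suc i mod 3)) \<in> arcs Q' \<or> (p (Suc i mod 3), p i) \<in> arcs Q'" if "i < 3" for i
  proof -
    let ?x = "node q i" and ?y = "node q (Suc i)"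
    have "(?x, ?y) \<in> hub_graph Q"
      using shift_hub_arc[of ?x Q] q that by (simp add: hub_graph_def)
    then have "(\<phi> ?x, \<phi> ?y) \<in> hub_graph Q'"
      using hom unfolding continuous_hom_def by blast
    moreover have "sep (p i) (\<phi> ?x) < \<delta>" "sep (p (Suc i mod 3)) (\<phi> ?y) < \<delta>"
      using near[of i] near[of "Suc i"] that q(2) by auto
    moreover have "\<delta> \<le> 1 / real (cyc (p i))" "\<delta> \<le> 1 / real (cyc (p (Suc i mod 3)))"
      using \<delta>(2) that by auto
    ultimately show ?thesis
      using limit_of_hub_arcs[of "\<phi> ?x" "\<phi> ?y" Q' "p i" "p (Suc i mod 3)"]
        limit_of_hub_arcs[of "\<phi> ?y" "\<phi> ?x" Q' "p (Suc i mod 3)" "p i"]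
        p[OF that] p[of "Suc i mod 3"]
      by (auto simp: hub_graph_def)
  qed
  have "(p 0, p 1) \<in> arcs Q' \<or> (p 1, p 0) \<in> arcs Q'"
    "(p 1, p 2) \<in> arcs Q' \<or> (p 2, p 1) \<in> arcs Q'"
    "(p 2, p 0) \<in> arcs Q' \<or> (p 0, p 2) \<in> arcs Q'"
    using adj[of 0] adj[of 1] adj[of 2] by (simp_all add: numeral_2_eq_2)
  note tri = arcs_triangle_oriented[OF this]
  have "cyc (p 0) = 1 \<and> cyc (p 1) = 1 \<and> cyc (p 2) = 1"
    using tri arcs_triangle_limit by meson
  then show "\<forall>i<3. cyc (\<phi> (node 1 i)) = 1"
    unfolding p_def by (metis less_3_cases)
  have s: "Suc 0 mod 3 = 1" "Suc 1 mod 3 = 2" "Suc 2 mod 3 = 0" by simp_all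
  from tri
  show "(\<forall>i<3. colour (\<phi> (node 1 (Suc i mod 3))) = Suc (colour (\<phi> (node 1 i))) mod 3) \<or>
        (\<forall>i<3. colour (\<phi> (node 1 i)) = Suc (colour (\<phi> (node 1 (Suc i mod 3)))) mod 3)"
    unfolding p_def by (metis arcs_colour less_3_cases s)
qed

text \<open>
  The image of a point \<open>x\<close> on a cycle is joined to the image of the hub of \<open>x\<close>, which is a hub. Since
  hubs have only outgoing arcs, this image lies on a cycle and its colour is determined by the
  colour of \<open>x\<close>. The direction of every step of the image is therefore the same.
\<close>

lemma hub_hom_subset:
  assumes prime: "\<And>q. q \<in> Q \<union> Q' \<Longrightarrow> prime q" and inf: "infinite Q"
    and le: "(cycle_space Q, hub_graph Q) \<preceq>\<^sub>c (cycle_space Q', hub_graph Q')"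
  shows "Q \<subseteq> Q'"
proof
  fix q assume q: "q \<in> Q"
  then have q2: "2 \<le> q" using prime prime_ge_2_nat by blast
  obtain \<phi> where hom: "continuous_hom (cycle_space Q) (hub_graph Q) (cycle_space Q') (hub_graph Q') \<phi>"
    using le by (auto simp: hom_le_def)
  have edge: "(\<phi> x, \<phi> y) \<in> hub_graph Q'" if "(x, y) \<in> hub_arcs Q" for x y
    using hom that unfolding continuous_hom_def hub_graph_def by blast
  define p where "p i = \<phi> (node 1 i)" for i
  note hubs = hom_hubs[OF inf hom, folded p_def]
  define v where "v k = (shift ^^ k) (node q 0)" for k
  define u where "u k = \<phi> (v k)" for k
  have v: "v k = node q (k mod (3 * q))" for k using q2 by (simp add: v_def funpow_shift_node)
  have vpts: "v k \<in> points Q" "cyc (v k) \<noteq> 1" for k using q q2 by (simp_all add: v)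
  have vcol: "colour (v k) = k mod 3" for k by (simp add: v mod_mod_cancel)
  have "(p ((k + 2) mod 3), u k) \<in> hub_arcs Q'" for k
  proof -
    have "(p ((k + 2) mod 3), u k) \<in> hub_graph Q'"
      using edge[OF hub_arc[OF vpts(1) vpts(2)]] by (simp add: vcol p_def u_def mod_simps)
    then show ?thesis using hubs(1) by (auto simp: hub_graph_def hub_arcs_def)
  qed
  then have u: "u k \<in> points Q'" "cyc (u k) \<noteq> 1"
      "colour (u k) = Suc (colour (p ((k + 2) mod 3))) mod 3" for k
    by (auto simp: hub_arcs_def arcs_def)
  have step: "u (Suc k) = shift (u k) \<and> colour (u (Suc k)) = Suc (colour (u k)) mod 3 \<or>
      u k = shift (u (Suc k)) \<and> colour (u k) = Suc (colour (u (Suc k))) mod 3" for k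
  proof -
    have "(u k, u (Suc k)) \<in> hub_graph Q'"
      using edge[OF shift_hub_arc[OF vpts(1) vpts(2)], of k] by (simp add: u_def v_def)
    then show ?thesis
      using u(2)[of k] u(2)[of "Suc k"] by (auto simp: hub_graph_def hub_arcs_def arcs_def)
  qed
  have nxt: "Suc ((k + 2) mod 3) mod 3 = (Suc k + 2) mod 3" for k :: nat by (simp add: mod_Suc_eq)
  have lt: "(k + 2) mod 3 < 3" for k :: nat by simp
  have no_two_cycle: "Suc (Suc a mod 3) mod 3 \<noteq> a" if "a < 3" for a
    using that by (auto simp: mod_Suc)
  have mono: "(\<forall>k. u (Suc k) = shift (u k)) \<or> (\<forall>k. u k = shift (u (Suc k)))"
    using hubs(2)
  proof
    assume *: "\<forall>i<3. colour (p (Suc i mod 3)) = Suc (colour (p i)) mod 3"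
    have "colour (u (Suc k)) = Suc (colour (u k)) mod 3" for k
      using *[rule_format, OF lt[of k]] by (simp only: u(3) nxt)
    then show ?thesis using step no_two_cycle colour_less by metis
  next
    assume *: "\<forall>i<3. colour (p i) = Suc (colour (p (Suc i mod 3))) mod 3"
    have "colour (u k) = Suc (colour (u (Suc k))) mod 3" for k
      using *[rule_format, OF lt[of k]] by (simp only: u(3) nxt)
    then show ?thesis using step no_two_cycle colour_less by metis
  qed
  have "u (3 * q) = u 0" by (simp add: u_def v)
  from monotone_walk_cyc_dvd[OF u(1) mono this] have "cyc (u 0) dvd q" by simp
  then have "cyc (u 0) = q" using prime q u(2) by (auto simp: prime_nat_iff)
  then show "q \<in> Q'" using u(1,2)[of 0] by (auto elim!: pointsE)
qed

section \<open>Embedding the power set\<close>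

text \<open>
  A set \<open>A\<close> is coded by the even numbers \<open>2n\<close> with \<open>n \<in> A\<close>; the odd numbers are added to every code to
  make it infinite.
\<close>

lemma power_set_embeds_into_infinite_sets_of_primes:
  obtains Q :: "nat set \<Rightarrow> nat set"
  where "\<And>A q. q \<in> Q A \<Longrightarrow> prime q" "\<And>A. infinite (Q A)" "\<And>A B. Q A \<subseteq> Q B \<longleftrightarrow> A \<subseteq> B"
proof -
  obtain h :: "nat \<Rightarrow> nat" where h: "inj h" "range h \<subseteq> {p. prime p}"
    using infinite_countable_subset[OF primes_infinite] by blast
  define E where "E A = (\<lambda>n. 2 * n) ` A \<union> range (\<lambda>n. 2 * n + 1)" for A :: "nat set"
  show thesis
  proof (rule that[of "\<lambda>A. h ` E A"])
    show "prime q" if "q \<in> h ` E A" for A q using h(2) that by auto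
    show "infinite (h ` E A)" for A
    proof -
      have "infinite (range (\<lambda>n::nat. 2 * n + 1))" by (rule range_inj_infinite) (simp add: inj_def)
      then show ?thesis using h(1) by (simp add: E_def finite_image_iff inj_on_subset)
    qed
    have "2 * n \<in> E A \<longleftrightarrow> n \<in> A" for n A by (auto simp: E_def double_not_eq_Suc_double)
    moreover have "E A \<subseteq> E B" if "A \<subseteq> B" for A B using that unfolding E_def by blast
    ultimately have "E A \<subseteq> E B \<longleftrightarrow> A \<subseteq> B" for A B by blast
    then show "h ` E A \<subseteq> h ` E B \<longleftrightarrow> A \<subseteq> B" for A B
      using h(1) by (simp add: inj_image_subset_iff)
  qed
qed

theorem theorem1p16:
  shows "(\<exists>\<Phi> :: nat set \<Rightarrow> (nat \<Rightarrow> bool) topology \<times> (nat \<Rightarrow> bool) rel.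
            (\<forall>A. \<Phi> A \<in> homeo_graph_class) \<and>
            (\<forall>A B. A \<subseteq> B \<longleftrightarrow> \<Phi> A \<preceq>\<^sup>i\<^sub>c \<Phi> B))
       \<and> (\<exists>\<Psi> :: nat set \<Rightarrow> (nat \<Rightarrow> bool) topology \<times> (nat \<Rightarrow> bool) rel.
            (\<forall>A. \<Psi> A \<in> countable_graph_class) \<and>
            (\<forall>A B. A \<subseteq> B \<longleftrightarrow> \<Psi> A \<preceq>\<^sub>c \<Psi> B))"
proof -
  obtain Q :: "nat set \<Rightarrow> nat set" where prime: "\<And>A q. q \<in> Q A \<Longrightarrow> prime q"
    and inf: "\<And>A. infinite (Q A)" and sub: "\<And>A B. Q A \<subseteq> Q B \<longleftrightarrow> A \<subseteq> B"
    by (rule power_set_embeds_into_infinite_sets_of_primes) blast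
  show ?thesis
  proof (intro conjI exI allI iffI)
    fix A B
    show "(cycle_space (Q A), cycle_graph (Q A)) \<in> homeo_graph_class"
      by (rule cycle_graph_in_class)
    show "(cycle_space (Q A), hub_graph (Q A)) \<in> countable_graph_class"
      by (rule hub_graph_in_class) (rule inf)
    show "A \<subseteq> B" if "(cycle_space (Q A), cycle_graph (Q A)) \<preceq>\<^sup>i\<^sub>c (cycle_space (Q B), cycle_graph (Q B))"
      using injective_hom_subset[OF _ that] prime sub by blast
    show "A \<subseteq> B" if "(cycle_space (Q A), hub_graph (Q A)) \<preceq>\<^sub>c (cycle_space (Q B), hub_graph (Q B))"
      using hub_hom_subset[OF _ inf that] prime sub by blast
    assume "A \<subseteq> B"
    then have AB: "Q A \<subseteq> Q B" by (simp add: sub)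
    show "(cycle_space (Q A), cycle_graph (Q A)) \<preceq>\<^sup>i\<^sub>c (cycle_space (Q B), cycle_graph (Q B))"
      unfolding inj_hom_le_def continuous_hom_def
      using continuous_inclusion[OF AB] points_mono[OF AB]
      by (intro exI[of _ "\<lambda>x. x"]) (auto simp: cycle_graph_iff)
    show "(cycle_space (Q A), hub_graph (Q A)) \<preceq>\<^sub>c (cycle_space (Q B), hub_graph (Q B))"
      unfolding hom_le_def continuous_hom_def
      using continuous_inclusion[OF AB] hub_graph_mono[OF AB]
      by (intro exI[of _ "\<lambda>x. x"]) auto
  qed
qed

end
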